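(* Let $f\colon 2^N\to\mathbb{R}_{\ge0}$ be non-negative submodular, $k\ge1$ an integer, and $\omega\ge1$. Consider the Window Containment algorithm: set $S_0=\emptyset$; for $t=0,1,\dots,k-1$, let $W_t$ be the set of the top $\min(\omega k,|N\setminus S_t|)$ elements of $N\setminus S_t$ ranked by $f(\cdot\mid S_t)$, pick $w_t$ uniformly at random from $W_t$, and set $S_{t+1}=S_t\cup\{w_t\}$; output $P_k = S_k\cup\bigcup_{t=0}^{k-1}W_t$. Then $|P_k|\le k+\omega k^2$ and, for every $k'\le k$, \[ \mathbb{E}\!\left[\max_{T\subseteq P_k,\,|T|\le k'} f(T)\right] \ge \frac{e^{-1/\omega}}{2}\cdot\mathrm{OPT}_{k'} \] asymptotically as $k\to\infty$; more precisely the lower bound $\frac{1}{2}\left(1-\frac{1}{\omega k}\right)^k\mathrm{OPT}_{k'} = \frac{e^{-1/\omega}}{2}\left(1-O\!\left(\frac{1}{\omega^2k}\right)\right)\mathrm{OPT}_{k'}$ holds, and in particular the factor tends to $1/2$ as $\omega\to\infty$. The algorithm uses $O(nk)$ value queries.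
   Context: $|N|=n$; $f(x\mid A)=f(A\cup\{x\})-f(A)$; $f$ is submodular if $f(x\mid A)\ge f(x\mid B)$ for $A\subseteq B$, $x\notin B$ ($f$ need not be monotone). $\mathrm{OPT}_{k'}=\max_{|S|\le k'} f(S)$. The expectation is over the random choices $w_t$. *)

theory Defs
  imports "HOL-Probability.Probability"
begin

section \<open>Submodular set functions\<close>

definition marginal :: "('a set \<Rightarrow> real) \<Rightarrow> 'a \<Rightarrow> 'a set \<Rightarrow> real" where
  "marginal f x A = f (A \<union> {x}) - f A"

definition submodular_on :: "'a set \<Rightarrow> ('a set \<Rightarrow> real) \<Rightarrow> bool" where
  "submodular_on N f \<longleftrightarrow>
     (\<forall>A B x. A \<subseteq> B \<and> B \<subseteq> N \<and> x \<in> N \<and> x \<notin> B \<longrightarrow> marginal f x A \<ge> marginal f x B)"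

definition nonneg_on :: "'a set \<Rightarrow> ('a set \<Rightarrow> real) \<Rightarrow> bool" where
  "nonneg_on N f \<longleftrightarrow> (\<forall>A. A \<subseteq> N \<longrightarrow> 0 \<le> f A)"

text \<open>For a finite ground set \<open>N\<close>, the value \<open>OPT\<close> for the budget \<open>k'\<close> is \<open>best f N k'\<close>.\<close>

definition best :: "('a set \<Rightarrow> real) \<Rightarrow> 'a set \<Rightarrow> nat \<Rightarrow> real" where
  "best f X k' = Max (f ` {T. T \<subseteq> X \<and> card T \<le> k'})"

section \<open>Randomized algorithms with a value oracle\<close>

text \<open>
  A program sees the set function only through its queries. \<open>Query F c\<close> asks for the values on all
  members of the finite family \<open>F\<close>, at a cost of one query per member, and continues with the
  table of answers, which is \<open>undefined\<close> outside \<open>F\<close>. \<open>Draw A c\<close> samples uniformly from the finite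
  nonempty set \<open>A\<close>. Execution yields the joint distribution of the result and the number of
  queries.
\<close>

datatype ('a, 'r) oracle_prog =
    Return 'r
  | Query "'a set set" "('a set \<Rightarrow> real) \<Rightarrow> ('a, 'r) oracle_prog"
  | Draw "'a set" "'a \<Rightarrow> ('a, 'r) oracle_prog"

primrec exec :: "('a set \<Rightarrow> real) \<Rightarrow> ('a, 'r) oracle_prog \<Rightarrow> ('r \<times> nat) pmf" where
  "exec f (Return r) = return_pmf (r, 0)"
| "exec f (Query F c) = map_pmf (\<lambda>(r, q). (r, card F + q)) (exec f (c (restrict f F)))"
| "exec f (Draw A c) = bind_pmf (pmf_of_set A) (\<lambda>a. exec f (c a))"

section \<open>Window Containment\<close>

definition is_top :: "nat \<Rightarrow> ('a \<Rightarrow> real) \<Rightarrow> 'a set \<Rightarrow> 'a set \<Rightarrow> bool" where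
  "is_top m g A W \<longleftrightarrow>
     W \<subseteq> A \<and> card W = min m (card A) \<and> (\<forall>x\<in>W. \<forall>y\<in>A - W. g y \<le> g x)"

text \<open>
  A ranking rule \<open>R\<close> maps the list \<open>h\<close> of elements picked so far and a score function to a window of
  top elements among those not yet picked; it embodies an arbitrary, possibly history-dependent,
  way of breaking ties.
\<close>

definition top_rule :: "'a set \<Rightarrow> nat \<Rightarrow> ('a list \<Rightarrow> ('a \<Rightarrow> real) \<Rightarrow> 'a set) \<Rightarrow> bool" where
  "top_rule N m R \<longleftrightarrow> (\<forall>h g. set h \<subseteq> N \<longrightarrow> is_top m g (N - set h) (R h g))"

text \<open>
  The first numeric argument counts the remaining iterations, \<open>h = [w\<^sub>0, \<dots>, w\<^bsub>t-1\<^esub>]\<close> lists the picks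
  so far, so that \<open>S\<^sub>t = set h\<close>, and \<open>U\<close> is the union of the windows so far. Once \<open>N\<close> is exhausted
  there is nothing left to pick, and the remaining iterations are void.
\<close>

primrec wc_loop ::
  "'a set \<Rightarrow> ('a list \<Rightarrow> ('a \<Rightarrow> real) \<Rightarrow> 'a set) \<Rightarrow> nat \<Rightarrow> 'a list \<Rightarrow> 'a set \<Rightarrow> ('a, 'a set) oracle_prog"
where
  "wc_loop N R 0 h U = Return (set h \<union> U)"
| "wc_loop N R (Suc r) h U =
     (if N - set h = {} then Return (set h \<union> U)
      else Query (insert (set h) ((\<lambda>x. set h \<union> {x}) ` (N - set h)))
        (\<lambda>v. let W = R h (\<lambda>x. marginal v x (set h))
             in Draw W (\<lambda>w. wc_loop N R r (h @ [w]) (U \<union> W))))"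

definition window_containment ::
  "'a set \<Rightarrow> ('a list \<Rightarrow> ('a \<Rightarrow> real) \<Rightarrow> 'a set) \<Rightarrow> nat \<Rightarrow> ('a, 'a set) oracle_prog" where
  "window_containment N R k = wc_loop N R k [] {}"

definition wc_output ::
  "'a set \<Rightarrow> ('a set \<Rightarrow> real) \<Rightarrow> ('a list \<Rightarrow> ('a \<Rightarrow> real) \<Rightarrow> 'a set) \<Rightarrow> nat \<Rightarrow> 'a set pmf" where
  "wc_output N f R k = map_pmf fst (exec f (window_containment N R k))"

definition wc_queries ::
  "'a set \<Rightarrow> ('a set \<Rightarrow> real) \<Rightarrow> ('a list \<Rightarrow> ('a \<Rightarrow> real) \<Rightarrow> 'a set) \<Rightarrow> nat \<Rightarrow> nat pmf" where
  "wc_queries N f R k = map_pmf snd (exec f (window_containment N R k))"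

text \<open>The window size \<open>\<omega>k\<close> is rounded up when it is not an integer.\<close>

definition wc_instance ::
  "'a set \<Rightarrow> ('a set \<Rightarrow> real) \<Rightarrow> nat \<Rightarrow> real \<Rightarrow> ('a list \<Rightarrow> ('a \<Rightarrow> real) \<Rightarrow> 'a set) \<Rightarrow> bool" where
  "wc_instance N f k \<omega> R \<longleftrightarrow>
     finite N \<and> nonneg_on N f \<and> submodular_on N f \<and> 1 \<le> k \<and> 1 \<le> \<omega> \<and>
     top_rule N (nat \<lceil>\<omega> * real k\<rceil>) R"

end

theory Submission
  imports Defs "HOL-Real_Asymp.Real_Asymp"
begin

text \<open>
  Fix an optimal set \<open>O\<close> for the budget \<open>k'\<close> and let \<open>P\<^sub>t\<close> be the union of the first \<open>t\<close> windows, which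
  contains \<open>S\<^sub>t\<close>. Stop at the first time \<open>t\<close> with \<open>|O - P\<^bsub>t+1\<^esub>| \<le> t\<close>, or at time \<open>k\<close>. At that moment
  \<open>|O - P\<^sub>t| \<ge> t\<close>, so some \<open>M\<close> with \<open>O - P\<^bsub>t+1\<^esub> \<subseteq> M \<subseteq> O - P\<^sub>t\<close> has exactly \<open>t\<close> elements, and both \<open>S\<^sub>t\<close>
  and \<open>T = S\<^sub>t \<union> (O - M)\<close> are feasible subsets of the output. The elements of \<open>M\<close> are in none of
  the first \<open>t\<close> windows, so their marginals are dominated by those of the picks \<open>w\<^sub>0, \<dots>, w\<^bsub>t-1\<^esub>\<close>; hence
  \<open>f (O \<union> S\<^sub>t) \<le> f T + f S\<^sub>t\<close>, and the output retains at least half of \<open>f (O \<union> S\<^sub>t)\<close>.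
  Before stopping, the window has full size \<open>m\<close>, and by submodularity and non-negativity one uniform
  pick from it decreases \<open>f (O \<union> S\<^sub>t)\<close> in expectation by a factor of at worst \<open>1 - 1 / m\<close>. As the
  stopping rule looks only at the past, these factors multiply up to the stopping time.
\<close>

section \<open>Maxima over subsets of bounded size\<close>

lemma le_best:
  assumes "finite X" "T \<subseteq> X" "card T \<le> k"
  shows "f T \<le> best f X k"
  unfolding best_def using assms by (intro Max_ge) auto

lemma best_attained:
  assumes "finite X"
  obtains T where "T \<subseteq> X" "card T \<le> k" "best f X k = f T"
proof -
  have "f ` {T. T \<subseteq> X \<and> card T \<le> k} \<noteq> {}"
    by (auto intro: exI[of _ "{}"])
  then have "best f X k \<in> f ` {T. T \<subseteq> X \<and> card T \<le> k}"
    unfolding best_def using assms by (intro Max_in) auto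
  then show ?thesis using that by auto
qed

section \<open>Inequalities from submodularity and non-negativity\<close>

text \<open>The elements of \<open>M\<close> are added one at a time, each to a superset of
  \<open>S\<close>. Letting \<open>S\<close> be smaller than \<open>B\<close> allows marginals over
  the picks alone to control the gain over a larger set.\<close>

lemma submodular_on_union_le:
  assumes "submodular_on N f" "finite M" "S \<subseteq> B" "B \<union> M \<subseteq> N" "M \<inter> B = {}"
  shows "f (B \<union> M) \<le> f B + (\<Sum>x\<in>M. marginal f x S)"
  using assms(2,4,5)
proof (induction M rule: finite_induct)
  case empty
  then show ?case by simp
next
  case (insert x M)
  have "marginal f x (B \<union> M) \<le> marginal f x S"
    using assms(1)[unfolded submodular_on_def, rule_format, of S "B \<union> M" x] assms(3) insert.hyps
      insert.prems by blast
  moreover have "f (B \<union> M) \<le> f B + (\<Sum>x\<in>M. marginal f x S)"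
    using insert.prems by (intro insert.IH) auto
  ultimately show ?case
    using insert.hyps by (simp add: marginal_def)
qed

text \<open>Adding all of \<open>W\<close> at once gains at most the sum of the marginals over
  \<open>B\<close>, and the resulting value is still non-negative, so that sum is at least
  \<open>- f B\<close>. Dividing by \<open>card W\<close> gives the loss factor of one uniform
  pick.\<close>

lemma sum_insert_nonneg_submodular_ge:
  assumes "submodular_on N f" "nonneg_on N f" "finite W" "B \<subseteq> N" "W \<subseteq> N"
  shows "(real (card W) - 1) * f B \<le> (\<Sum>w\<in>W. f (B \<union> {w}))"
proof -
  have "f (B \<union> (W - B)) \<le> f B + (\<Sum>w\<in>W - B. marginal f w B)"
    using assms by (intro submodular_on_union_le) auto
  \<comment> \<open>Elements already in \<open>B\<close> have marginal zero.\<close>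
  moreover have "(\<Sum>w\<in>W - B. marginal f w B) = (\<Sum>w\<in>W. marginal f w B)"
    using assms(3) by (intro sum.mono_neutral_left) (auto simp: marginal_def insert_absorb)
  moreover have "0 \<le> f (B \<union> (W - B))"
    using assms by (auto simp: nonneg_on_def)
  moreover have "(\<Sum>w\<in>W. marginal f w B) = (\<Sum>w\<in>W. f (B \<union> {w})) - card W * f B"
    by (simp add: marginal_def sum_subtractf)
  ultimately show ?thesis by (simp add: algebra_simps)
qed

text \<open>The stopping step; scaling the marginals by \<open>card M\<close> avoids pairing \<open>M\<close> with the picks.\<close>

lemma union_le_twice_best:
  assumes "submodular_on N f" "nonneg_on N f" "finite N" "P \<subseteq> N" "Opt \<subseteq> N"
    and "M \<subseteq> Opt - S" "card S \<le> card M" "card Opt \<le> k" "S \<union> (Opt - M) \<subseteq> P"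
    and dom: "\<And>x. x \<in> M \<Longrightarrow> real (card M) * marginal f x S \<le> f S - f {}"
  shows "f (Opt \<union> S) \<le> 2 * best f P k"
proof -
  have fin: "finite P" "finite M" "finite Opt" "finite S"
    using assms by (meson finite_subset le_supE finite_Diff)+
  have "f ((S \<union> (Opt - M)) \<union> M) \<le> f (S \<union> (Opt - M)) + (\<Sum>x\<in>M. marginal f x S)"
    using assms fin by (intro submodular_on_union_le) auto
  moreover have "(S \<union> (Opt - M)) \<union> M = Opt \<union> S"
    using assms by auto
  moreover have "(\<Sum>x\<in>M. marginal f x S) \<le> f S"
  proof (cases "M = {}")
    case True
    then show ?thesis using assms by (auto simp: nonneg_on_def)
  next
    case False
    then have pos: "real (card M) > 0" using fin by (simp add: card_gt_0_iff)
    have "marginal f x S \<le> (f S - f {}) / card M" if "x \<in> M" for x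
      using dom[OF that] pos by (simp add: field_simps)
    then have "(\<Sum>x\<in>M. marginal f x S) \<le> real (card M) * ((f S - f {}) / card M)"
      by (rule sum_bounded_above)
    then show ?thesis
      using pos assms(2) by (simp add: nonneg_on_def) (smt (verit) empty_subsetI)
  qed
  moreover have cM: "card M \<le> card Opt"
    using assms fin by (intro card_mono) auto
  have "f S \<le> best f P k"
    using assms fin cM by (intro le_best) auto
  \<comment> \<open>Removing \<open>M\<close> from \<open>Opt\<close> frees at least as many places
    as \<open>S\<close> takes.\<close>
  moreover have "f (S \<union> (Opt - M)) \<le> best f P k"
  proof (intro le_best)
    have "card (S \<union> (Opt - M)) \<le> card S + card (Opt - M)"
      by (rule card_Un_le)
    also have "card (Opt - M) = card Opt - card M"
      using assms fin by (intro card_Diff_subset) auto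
    finally show "card (S \<union> (Opt - M)) \<le> k"
      using assms cM by linarith
  qed (use assms fin in auto)
  ultimately show ?thesis by simp
qed

lemma pmf_expectation_ge_const:
  fixes g :: "'b \<Rightarrow> real"
  assumes "finite (set_pmf p)" "\<And>x. x \<in> set_pmf p \<Longrightarrow> c \<le> g x"
  shows "c \<le> measure_pmf.expectation p g"
  using assms
  by (intro measure_pmf.integral_ge_const integrable_measure_pmf_finite)
    (auto simp: AE_measure_pmf_iff)

section \<open>The random process, its windows and its support\<close>

locale window_process =
  fixes N :: "'a set" and f :: "'a set \<Rightarrow> real" and m :: nat
    and R :: "'a list \<Rightarrow> ('a \<Rightarrow> real) \<Rightarrow> 'a set"
  assumes fin: "finite N" and nonneg: "nonneg_on N f" and submod: "submodular_on N f"
    and m_pos: "1 \<le> m" and rule: "top_rule N m R"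
begin

text \<open>The rule receives a whole score function, including scores outside \<open>N\<close>,
  where the table of answers is undefined. Hence the table itself appears here: scores computed from
  \<open>f\<close> could lead to a different window.\<close>

definition window :: "'a list \<Rightarrow> 'a set" where
  "window h = R h (\<lambda>x. marginal (restrict f (insert (set h) ((\<lambda>x. set h \<union> {x}) ` (N - set h)))) x (set h))"

abbreviation output_from :: "nat \<Rightarrow> 'a list \<Rightarrow> 'a set \<Rightarrow> 'a set pmf" where
  "output_from r h U \<equiv> map_pmf fst (exec f (wc_loop N R r h U))"

text \<open>The queries cover \<open>set h\<close> and all its extensions by one unpicked element,
  so table and \<open>f\<close> give equal marginals on \<open>N - set h\<close>, the only place
  where \<open>is_top\<close> compares scores.\<close>

lemma is_top_window:
  assumes "set h \<subseteq> N"
  shows "is_top m (\<lambda>x. marginal f x (set h)) (N - set h) (window h)"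
proof -
  let ?v = "restrict f (insert (set h) ((\<lambda>x. set h \<union> {x}) ` (N - set h)))"
  have top: "is_top m (\<lambda>x. marginal ?v x (set h)) (N - set h) (window h)"
    unfolding window_def using rule assms by (simp add: top_rule_def)
  have eq: "marginal ?v x (set h) = marginal f x (set h)" if "x \<in> N - set h" for x
    using that by (auto simp: marginal_def)
  have "marginal f y (set h) \<le> marginal f x (set h)"
    if "x \<in> window h" "y \<in> N - set h - window h" for x y
  proof -
    have "x \<in> N - set h" "y \<in> N - set h" using that top by (auto simp: is_top_def)
    moreover have "marginal ?v y (set h) \<le> marginal ?v x (set h)"
      using that top unfolding is_top_def by blast
    ultimately show ?thesis using eq by metis
  qed
  then show ?thesis using top by (simp add: is_top_def)
qed

lemma window_subset: "set h \<subseteq> N \<Longrightarrow> window h \<subseteq> N - set h"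
  and window_dominates: "set h \<subseteq> N \<Longrightarrow> x \<in> window h \<Longrightarrow> y \<in> N - set h - window h \<Longrightarrow>
    marginal f y (set h) \<le> marginal f x (set h)"
  and card_window: "set h \<subseteq> N \<Longrightarrow> card (window h) = min m (card (N - set h))"
  using is_top_window by (auto simp: is_top_def)

lemma finite_window: "set h \<subseteq> N \<Longrightarrow> finite (window h)"
  using window_subset fin by (meson finite_Diff finite_subset)

lemma window_nonempty: "set h \<subseteq> N \<Longrightarrow> N - set h \<noteq> {} \<Longrightarrow> window h \<noteq> {}"
  using card_window[of h] m_pos fin card_gt_0_iff[of "N - set h"] by auto

lemma output_from_exhausted: "N - set h = {} \<Longrightarrow> output_from r h U = return_pmf (set h \<union> U)"
  by (cases r) auto

lemma output_from_Suc:
  assumes "N - set h \<noteq> {}"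
  shows "output_from (Suc r) h U =
    bind_pmf (pmf_of_set (window h)) (\<lambda>w. output_from r (h @ [w]) (U \<union> window h))"
  using assms
  by (simp add: window_def Let_def map_bind_pmf pmf.map_comp o_def case_prod_beta)

lemma set_pmf_output_from_Suc:
  assumes "N - set h \<noteq> {}" "set h \<subseteq> N"
  shows "set_pmf (output_from (Suc r) h U) =
    (\<Union>w\<in>window h. set_pmf (output_from r (h @ [w]) (U \<union> window h)))"
  unfolding output_from_Suc[OF assms(1)]
  using window_nonempty finite_window assms by simp

lemma extend_history:
  assumes "set h \<subseteq> U" "U \<subseteq> N" "w \<in> window h"
  shows "set (h @ [w]) \<subseteq> U \<union> window h" "U \<union> window h \<subseteq> N"
  using assms window_subset[of h] by auto

text \<open>Each round adds one window of at most \<open>m\<close> elements; the pick lies in it and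
  costs nothing extra. Finite support serves the later computations with expectations.\<close>

lemma output_from_support:
  assumes "set h \<subseteq> U" "U \<subseteq> N"
  shows "finite (set_pmf (output_from r h U)) \<and>
    (\<forall>P\<in>set_pmf (output_from r h U). U \<subseteq> P \<and> P \<subseteq> N \<and> card P \<le> card U + r * m)"
  using assms
proof (induction r arbitrary: h U)
  case 0
  then show ?case by (simp add: Un_absorb1)
next
  case (Suc r)
  have h: "set h \<subseteq> N" using Suc by auto
  show ?case
  proof (cases "N - set h = {}")
    case True
    then show ?thesis
      using output_from_exhausted[OF True, of "Suc r" U] Suc by (simp add: Un_absorb1)
  next
    case False
    have "card (U \<union> window h) \<le> card U + m"
      using card_Un_le[of U "window h"] card_window[OF h] by linarith
    then have "U \<subseteq> P \<and> P \<subseteq> N \<and> card P \<le> card U + Suc r * m"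
      if "w \<in> window h" "P \<in> set_pmf (output_from r (h @ [w]) (U \<union> window h))" for w P
      using Suc.IH[OF extend_history[OF Suc.prems that(1)]] that(2) by force
    moreover have "finite (set_pmf (output_from r (h @ [w]) (U \<union> window h)))"
      if "w \<in> window h" for w
      using Suc.IH[OF extend_history[OF Suc.prems that]] by blast
    ultimately show ?thesis
      unfolding set_pmf_output_from_Suc[OF False h] using finite_window[OF h] by blast
  qed
qed

text \<open>The current window survives whatever is picked from it, so the stopping test may look
  one window ahead.\<close>

lemma output_from_support_window:
  assumes "set h \<subseteq> U" "U \<subseteq> N" "N - set h \<noteq> {}" "P \<in> set_pmf (output_from (Suc r) h U)"
  shows "U \<union> window h \<subseteq> P"
proof -
  have "set h \<subseteq> N" using assms(1,2) by blast
  then obtain w where w: "w \<in> window h" "P \<in> set_pmf (output_from r (h @ [w]) (U \<union> window h))"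
    using assms(4) unfolding set_pmf_output_from_Suc[OF assms(3) \<open>set h \<subseteq> N\<close>] by blast
  show ?thesis
    using output_from_support[OF extend_history[OF assms(1,2) w(1)]] w(2) by blast
qed

lemma expectation_output_from_Suc:
  fixes g :: "'a set \<Rightarrow> real"
  assumes "set h \<subseteq> U" "U \<subseteq> N" "N - set h \<noteq> {}"
  shows "measure_pmf.expectation (output_from (Suc r) h U) g =
    (\<Sum>w\<in>window h. measure_pmf.expectation (output_from r (h @ [w]) (U \<union> window h)) g)
      / card (window h)"
proof -
  have h: "set h \<subseteq> N" using assms by auto
  note W = finite_window[OF h] window_nonempty[OF h assms(3)]
  have "measure_pmf.expectation (output_from (Suc r) h U) g =
    (\<Sum>w\<in>window h. pmf (pmf_of_set (window h)) w *\<^sub>R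
       measure_pmf.expectation (output_from r (h @ [w]) (U \<union> window h)) g)"
    unfolding output_from_Suc[OF assms(3)]
    using W output_from_support[OF extend_history[OF assms(1,2)]]
    by (intro pmf_expectation_bind) auto
  then show ?thesis
    using W by (simp add: sum_divide_distrib)
qed

section \<open>The expected value retained by the output\<close>

text \<open>Since \<open>x\<close> misses the window, its marginal is at most that of
  \<open>w\<close>; adding this to the hypothesis telescopes the gains of the picks. Submodularity
  then passes from \<open>set h\<close> to \<open>set (h @ [w])\<close>.\<close>

lemma picks_dominate_extend:
  assumes "set h \<subseteq> U" "U \<subseteq> N" "w \<in> window h" "x \<in> N - (U \<union> window h)"
    and "real (length h) * marginal f x (set h) \<le> f (set h) - f {}"
  shows "real (length (h @ [w])) * marginal f x (set (h @ [w])) \<le> f (set (h @ [w])) - f {}"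
proof -
  have h: "set h \<subseteq> N" using assms by auto
  have w: "w \<in> N" "w \<notin> set h" "w \<noteq> x" using window_subset[OF h] assms by auto
  have mono: "marginal f x (set (h @ [w])) \<le> marginal f x (set h)"
    using submod[unfolded submodular_on_def, rule_format, of "set h" "set (h @ [w])" x] w h assms
    by auto
  have "marginal f x (set h) \<le> marginal f w (set h)"
    using window_dominates[OF h] assms by blast
  then have "real (length h + 1) * marginal f x (set h) \<le> f (set (h @ [w])) - f {}"
    using assms(5) by (simp add: marginal_def algebra_simps)
  moreover have "real (length h + 1) * marginal f x (set (h @ [w])) \<le> real (length h + 1) * marginal f x (set h)"
    using mono by (intro mult_left_mono) auto
  ultimately have "real (length h + 1) * marginal f x (set (h @ [w])) \<le> f (set (h @ [w])) - f {}"
    by (rule order_trans[rotated])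
  then show ?thesis by simp
qed

text \<open>Induction on the remaining rounds \<open>r\<close> replaces a formal stopping time: each
  round either stops or recurses. That the process has not stopped earlier is recorded by
  \<open>length h \<le> card (Opt - U)\<close>.\<close>

lemma expectation_best_ge:
  assumes "Opt \<subseteq> N" "card Opt \<le> k'" "card Opt \<le> length h + r"
    and "set h \<subseteq> U" "U \<subseteq> N" "length h \<le> card (Opt - U)"
    and "\<And>x. x \<in> N - U \<Longrightarrow> real (length h) * marginal f x (set h) \<le> f (set h) - f {}"
  shows "1 / 2 * (1 - 1 / real m) ^ r * f (Opt \<union> set h)
    \<le> measure_pmf.expectation (output_from r h U) (\<lambda>P. best f P k')"
  using assms(3-)
proof (induction r arbitrary: h U)
  case (0 h U)
  have fO: "finite Opt" using assms fin finite_subset by blast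
  have "card (Opt - U) \<le> card Opt" using fO by (intro card_mono) auto
  \<comment> \<open>With no rounds left,
    \<open>length h \<le> card (Opt - U) \<le> card Opt \<le> length h\<close>, so
    \<open>M = Opt - U\<close> has the required size.\<close>
  then have c: "card (Opt - U) = length h" using 0 by linarith
  have "f (Opt \<union> set h) \<le> 2 * best f U k'"
    using 0 assms c card_length[of h]
    by (intro union_le_twice_best[OF submod nonneg fin, where M = "Opt - U"]) auto
  then show ?case using 0 by (simp add: Un_absorb1)
next
  case (Suc r h U)
  have fO: "finite Opt" using assms fin finite_subset by blast
  have h: "set h \<subseteq> N" using Suc by auto
  have nn: "0 \<le> f (Opt \<union> set h)" using assms h nonneg by (auto simp: nonneg_on_def)
  have q01: "0 \<le> 1 - 1 / real m" "1 - 1 / real m \<le> 1" using m_pos by auto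
  \<comment> \<open>Stopping gives the factor 1/2 for every possible output; the remaining power is
    at most 1 and is given away. \<open>V\<close> is a set that all outputs contain.\<close>
  have stop: ?case
    if V: "card (Opt - V) \<le> length h" "U \<subseteq> V"
      "\<And>P. P \<in> set_pmf (output_from (Suc r) h U) \<Longrightarrow> V \<subseteq> P" for V
  proof -
    \<comment> \<open>\<open>M\<close> avoids \<open>U\<close>, so the picks dominate it, while
      \<open>Opt - M\<close> lies in \<open>V\<close> and hence in the output.\<close>
    obtain M where M: "Opt - V \<subseteq> M" "M \<subseteq> Opt - U" "card M = length h"
      using exists_subset_between[of "Opt - V" "length h" "Opt - U"] V Suc.prems(4) fO by blast
    have "1 / 2 * f (Opt \<union> set h) \<le> best f P k'"
      if P: "P \<in> set_pmf (output_from (Suc r) h U)" for P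
    proof -
      have "P \<subseteq> N" using output_from_support[OF Suc.prems(2,3)] P by blast
      then have "f (Opt \<union> set h) \<le> 2 * best f P k'"
      proof (rule union_le_twice_best[OF submod nonneg fin])
        show "real (card M) * marginal f x (set h) \<le> f (set h) - f {}" if "x \<in> M" for x
          unfolding M(3) using that M(2) assms(1) by (intro Suc.prems(5)) blast
        show "card (set h) \<le> card M" unfolding M(3) by (rule card_length)
        show "M \<subseteq> Opt - set h" "set h \<union> (Opt - M) \<subseteq> P"
          using M(1,2) V(2) V(3)[OF P] Suc.prems(2) by blast+
      qed (fact assms(1,2))+
      then show ?thesis by simp
    qed
    then have "1 / 2 * f (Opt \<union> set h)
        \<le> measure_pmf.expectation (output_from (Suc r) h U) (\<lambda>P. best f P k')"
      using output_from_support[OF Suc.prems(2,3)] by (intro pmf_expectation_ge_const) blast+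
    moreover have "(1 - 1 / real m) ^ Suc r * f (Opt \<union> set h) \<le> 1 * f (Opt \<union> set h)"
      using nn q01 by (intro mult_right_mono power_le_one) auto
    ultimately show ?thesis by linarith
  qed
  show ?case
  proof (cases "N - set h = {}")
    case True
    then have "Opt - U = {}" using Suc.prems assms(1) by blast
    then show ?thesis
      using output_from_support[OF Suc.prems(2,3)] by (intro stop[of U]) (metis card.empty le0, blast+)
  next
    case False
    show ?thesis
    proof (cases "card (Opt - (U \<union> window h)) \<le> length h")
      case True
      then show ?thesis
        using output_from_support_window[OF Suc.prems(2,3) False]
        by (intro stop[of "U \<union> window h"]) blast+
    next
      case nonstop: False
      let ?W = "window h"
      \<comment> \<open>An element of \<open>Opt\<close> is still outside all windows, so the
        current window does not exhaust the unpicked elements and has full size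
        \<open>m\<close>.\<close>
      have "\<not> N - set h \<subseteq> ?W"
      proof
        assume "N - set h \<subseteq> ?W"
        then have "Opt - (U \<union> ?W) = {}" using Suc.prems assms(1) by blast
        with nonstop show False by (metis card.empty le0)
      qed
      then have "card ?W \<noteq> card (N - set h)"
        using window_subset[OF h] card_subset_eq[of "N - set h" ?W] fin by blast
      then have cW: "card ?W = m" using card_window[OF h] by linarith
      let ?q = "(1 - 1 / real m) ^ r"
      let ?E = "\<lambda>w. measure_pmf.expectation (output_from r (h @ [w]) (U \<union> ?W)) (\<lambda>P. best f P k')"
      have step: "1 / 2 * ?q * f ((Opt \<union> set h) \<union> {w}) \<le> ?E w" if w: "w \<in> ?W" for w
      proof -
        have "1 / 2 * ?q * f (Opt \<union> set (h @ [w])) \<le> ?E w"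
        proof (rule Suc.IH)
          show "card Opt \<le> length (h @ [w]) + r" using Suc.prems by simp
          \<comment> \<open>Failure of the stopping test is a strict inequality, which pays for the
            longer history.\<close>
          show "length (h @ [w]) \<le> card (Opt - (U \<union> ?W))" using nonstop by simp
          show "real (length (h @ [w])) * marginal f x (set (h @ [w])) \<le> f (set (h @ [w])) - f {}"
            if "x \<in> N - (U \<union> ?W)" for x
            using that Suc.prems w by (intro picks_dominate_extend) auto
        qed (fact extend_history[OF Suc.prems(2,3) w])+
        then show ?thesis by simp
      qed
      have "1 / 2 * ?q * ((real m - 1) * f (Opt \<union> set h))
          \<le> 1 / 2 * ?q * (\<Sum>w\<in>?W. f ((Opt \<union> set h) \<union> {w}))"
        using sum_insert_nonneg_submodular_ge[OF submod nonneg finite_window[OF h], of "Opt \<union> set h"]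
          q01 assms(1) h window_subset[OF h] cW
        by (intro mult_left_mono) auto
      also have "\<dots> \<le> (\<Sum>w\<in>?W. ?E w)"
        unfolding sum_distrib_left using step by (intro sum_mono) auto
      finally have "1 / 2 * ?q * ((real m - 1) * f (Opt \<union> set h)) / m \<le> (\<Sum>w\<in>?W. ?E w) / m"
        by (rule divide_right_mono) simp
      also have "\<dots> = measure_pmf.expectation (output_from (Suc r) h U) (\<lambda>P. best f P k')"
        unfolding expectation_output_from_Suc[OF Suc.prems(2,3) False] cW ..
      finally show ?thesis
        using m_pos by (simp add: field_simps)
    qed
  qed
qed

section \<open>Number of value queries\<close>

lemma queries_le:
  assumes "set h \<subseteq> N" "(P, q) \<in> set_pmf (exec f (wc_loop N R r h U))"
  shows "q \<le> r * (2 * card N)"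
  using assms
proof (induction r arbitrary: h U P q)
  case 0
  then show ?case by simp
next
  case (Suc r)
  show ?case
  proof (cases "N - set h = {}")
    case True
    then show ?thesis using Suc by simp
  next
    case False
    let ?F = "insert (set h) ((\<lambda>x. set h \<union> {x}) ` (N - set h))"
    have W: "window h \<subseteq> N - set h" "window h \<noteq> {}" "finite (window h)"
      using Suc.prems False window_subset window_nonempty finite_window by auto
    obtain w q' where w: "w \<in> window h" "q = card ?F + q'"
        "(P, q') \<in> set_pmf (exec f (wc_loop N R r (h @ [w]) (U \<union> window h)))"
      using Suc.prems(2) False W
      by (auto simp: Let_def window_def simp del: Un_insert_right)
    have "card ?F \<le> Suc (card ((\<lambda>x. set h \<union> {x}) ` (N - set h)))"
      by (rule card_insert_le_m1) auto
    also have "\<dots> \<le> Suc (card (N - set h))"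
      using card_image_le[of "N - set h"] fin by simp
    also have "\<dots> \<le> Suc (card N)"
      using fin by (simp add: card_mono)
    \<comment> \<open>A querying round has an unpicked element, so \<open>N\<close> is nonempty and
      the extra query for \<open>set h\<close> is absorbed by the factor 2.\<close>
    also have "\<dots> \<le> 2 * card N"
      using False fin by (cases "card N") auto
    finally have "card ?F \<le> 2 * card N" .
    moreover have "q' \<le> r * (2 * card N)"
      using w W Suc.prems(1) by (intro Suc.IH[OF _ w(3)]) auto
    ultimately show ?thesis using w(2) by simp
  qed
qed

end

section \<open>Comparing the power with its exponential limit\<close>

text \<open>With \<open>u = y / k\<close> the product is the \<open>k\<close>-th power of
  \<open>exp u * (1 - u)\<close>, which lies between \<open>1 - u\<^sup>2\<close> and 1; Bernoulli's
  inequality gives the lower bound.\<close>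

lemma power_one_minus_div_exp_bounds:
  fixes y :: real
  assumes "0 \<le> y" "y \<le> 1" "1 \<le> k"
  shows "exp y * (1 - y / real k) ^ k \<le> 1" "1 - y\<^sup>2 / real k \<le> exp y * (1 - y / real k) ^ k"
proof -
  define u where "u = y / real k"
  have u: "0 \<le> u" "u \<le> 1" "y = real k * u"
    using assms by (auto simp: u_def field_simps)
  have eq: "exp y * (1 - y / real k) ^ k = (exp u * (1 - u)) ^ k"
    using u by (simp add: u_def[symmetric] exp_of_nat_mult power_mult_distrib)
  have "1 - u \<le> exp (- u)"
    using exp_ge_add_one_self[of "- u"] by simp
  then have "exp u * (1 - u) \<le> 1"
    by (simp add: exp_minus field_simps)
  then show "exp y * (1 - y / real k) ^ k \<le> 1"
    unfolding eq using u by (intro power_le_one) auto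
  have "(1 + u) * (1 - u) \<le> exp u * (1 - u)"
    using u by (intro mult_right_mono) auto
  then have *: "1 - u\<^sup>2 \<le> exp u * (1 - u)"
    by (simp add: algebra_simps power2_eq_square)
  have u2: "u\<^sup>2 \<le> 1" using u by (simp add: power_le_one)
  have "1 - y\<^sup>2 / real k = 1 + real k * (- u\<^sup>2)"
    using assms u by (simp add: power2_eq_square)
  also have "\<dots> \<le> (1 + (- u\<^sup>2)) ^ k"
    using u2 by (intro Bernoulli_inequality) auto
  also have "\<dots> \<le> (exp u * (1 - u)) ^ k"
    using * u2 by (intro power_mono) auto
  finally show "1 - y\<^sup>2 / real k \<le> exp y * (1 - y / real k) ^ k"
    unfolding eq .
qed

text \<open>Chosen so that the finite factor equals the limit factor times
  \<open>1 - rel_error \<omega> k\<close> exactly.\<close>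

definition rel_error :: "real \<Rightarrow> nat \<Rightarrow> real" where
  "rel_error \<omega> k = 1 - exp (1 / \<omega>) * (1 - 1 / (\<omega> * real k)) ^ k"

lemma rel_error_bounds:
  assumes "1 \<le> \<omega>" "1 \<le> k"
  shows "0 \<le> rel_error \<omega> k" "rel_error \<omega> k \<le> 1 / (\<omega>\<^sup>2 * real k)"
  using power_one_minus_div_exp_bounds[of "1 / \<omega>" k] assms
  by (auto simp: rel_error_def power_divide)

lemma factor_eq_rel_error:
  "1 / 2 * (1 - 1 / (\<omega> * real k)) ^ k = exp (- 1 / \<omega>) / 2 * (1 - rel_error \<omega> k)"
proof -
  have "exp (- 1 / \<omega>) * exp (1 / \<omega>) = 1"
    by (simp flip: exp_add)
  then show ?thesis by (simp add: rel_error_def)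
qed

section \<open>Specialization to the rounded window size\<close>

context
  fixes N :: "'a set" and f k \<omega> R
  assumes inst: "wc_instance N f k \<omega> R"
begin

interpretation window_process N f "nat \<lceil>\<omega> * real k\<rceil>" R
proof
  have "1 * 1 \<le> \<omega> * real k"
    using inst by (intro mult_mono) (auto simp: wc_instance_def)
  then show "1 \<le> nat \<lceil>\<omega> * real k\<rceil>" by linarith
qed (use inst in \<open>auto simp: wc_instance_def\<close>)

lemma instance_params: "1 \<le> \<omega>" "1 \<le> k" "1 \<le> \<omega> * real k"
proof -
  show w: "1 \<le> \<omega>" and k: "1 \<le> k" using inst by (auto simp: wc_instance_def)
  show "1 \<le> \<omega> * real k" using mult_mono[of 1 \<omega> 1 "real k"] w k by simp
qed

lemma best_ground_nonneg: "0 \<le> best f N k'"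
proof -
  have "f {} \<le> best f N k'" by (intro le_best) (auto simp: fin)
  then show ?thesis using nonneg[unfolded nonneg_on_def, rule_format, of "{}"] by simp
qed

lemma wc_output_card_le:
  assumes "P \<in> set_pmf (wc_output N f R k)"
  shows "real (card P) \<le> real k + \<omega> * (real k)\<^sup>2"
proof -
  have "card P \<le> k * nat \<lceil>\<omega> * real k\<rceil>"
    using output_from_support[of "[]" "{}" k] assms
    by (auto simp: wc_output_def window_containment_def)
  then have "real (card P) \<le> real k * real (nat \<lceil>\<omega> * real k\<rceil>)"
    by (metis of_nat_le_iff of_nat_mult)
  \<comment> \<open>Rounding up costs less than one element per round; this accounts for the summand
    \<open>k\<close> of the bound.\<close>
  also have "\<dots> \<le> real k * (\<omega> * real k + 1)"
    using instance_params by (intro mult_left_mono) linarith+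
  finally show ?thesis by (simp add: algebra_simps power2_eq_square)
qed

lemma wc_output_expectation_ge:
  assumes "k' \<le> k"
  shows "1 / 2 * (1 - 1 / (\<omega> * real k)) ^ k * best f N k'
    \<le> measure_pmf.expectation (wc_output N f R k) (\<lambda>P. best f P k')"
proof -
  let ?m = "nat \<lceil>\<omega> * real k\<rceil>"
  obtain Opt where Opt: "Opt \<subseteq> N" "card Opt \<le> k'" "best f N k' = f Opt"
    using best_attained[OF fin] .
  \<comment> \<open>Rounding up only improves the factor; this first inequality keeps the smaller
    base non-negative.\<close>
  have "1 / (\<omega> * real k) \<le> 1" using instance_params by simp
  moreover have "1 / real ?m \<le> 1 / (\<omega> * real k)"
    using instance_params by (intro divide_left_mono mult_pos_pos) linarith+
  ultimately have "(1 - 1 / (\<omega> * real k)) ^ k \<le> (1 - 1 / real ?m) ^ k"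
    by (intro power_mono) auto
  then have "1 / 2 * (1 - 1 / (\<omega> * real k)) ^ k * best f N k' \<le> 1 / 2 * (1 - 1 / real ?m) ^ k * f Opt"
    unfolding Opt(3)[symmetric] using best_ground_nonneg by (intro mult_right_mono) auto
  also have "\<dots> \<le> measure_pmf.expectation (wc_output N f R k) (\<lambda>P. best f P k')"
    using expectation_best_ge[of Opt k' "[]" k "{}"] Opt assms
    by (simp add: wc_output_def window_containment_def)
  finally show ?thesis .
qed

lemma wc_queries_le:
  assumes "q \<in> set_pmf (wc_queries N f R k)"
  shows "real q \<le> 2 * (real (card N) * real k)"
proof -
  have "q \<le> k * (2 * card N)"
    using assms queries_le[of "[]"] by (auto simp: wc_queries_def window_containment_def)
  then have "real q \<le> real (k * (2 * card N))" by (rule of_nat_mono)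
  then show ?thesis by (simp add: mult_ac)
qed

end

theorem theorem3:
  shows
    "(\<forall>(N :: 'a set) f k \<omega> R. wc_instance N f k \<omega> R \<longrightarrow>
        (\<forall>P \<in> set_pmf (wc_output N f R k). real (card P) \<le> real k + \<omega> * (real k)\<^sup>2) \<and>
        (\<forall>k'\<le>k. measure_pmf.expectation (wc_output N f R k) (\<lambda>P. best f P k')
                  \<ge> 1 / 2 * (1 - 1 / (\<omega> * real k)) ^ k * best f N k')) \<and>
     (\<exists>C (\<delta> :: real \<Rightarrow> nat \<Rightarrow> real).
        (\<forall>\<omega>\<ge>1. \<forall>k\<ge>1. \<bar>\<delta> \<omega> k\<bar> \<le> C * (1 / (\<omega>\<^sup>2 * real k))) \<and>
        (\<forall>(N :: 'a set) f k \<omega> R. wc_instance N f k \<omega> R \<longrightarrow>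
          (\<forall>k'\<le>k. 1 / 2 * (1 - 1 / (\<omega> * real k)) ^ k * best f N k'
                    = exp (- 1 / \<omega>) / 2 * (1 - \<delta> \<omega> k) * best f N k'))) \<and>
     (\<forall>\<omega>\<ge>1. \<forall>\<epsilon>>0. \<forall>\<^sub>F k in sequentially.
        \<forall>(N :: 'a set) f R. wc_instance N f k \<omega> R \<longrightarrow>
          (\<forall>k'\<le>k. measure_pmf.expectation (wc_output N f R k) (\<lambda>P. best f P k')
                    \<ge> (1 - \<epsilon>) * (exp (- 1 / \<omega>) / 2) * best f N k')) \<and>
     ((\<lambda>\<omega>::real. exp (- 1 / \<omega>) / 2) \<longlongrightarrow> 1 / 2) at_top \<and>
     (\<forall>k\<ge>1. ((\<lambda>\<omega>::real. 1 / 2 * (1 - 1 / (\<omega> * real k)) ^ k) \<longlongrightarrow> 1 / 2) at_top) \<and>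
     (\<exists>C::real. \<forall>(N :: 'a set) f k \<omega> R. wc_instance N f k \<omega> R \<longrightarrow>
        (\<forall>q \<in> set_pmf (wc_queries N f R k). real q \<le> C * (real (card N) * real k)))"
proof (intro conjI)
  show "\<forall>(N :: 'a set) f k \<omega> R. wc_instance N f k \<omega> R \<longrightarrow>
      (\<forall>P \<in> set_pmf (wc_output N f R k). real (card P) \<le> real k + \<omega> * (real k)\<^sup>2) \<and>
      (\<forall>k'\<le>k. measure_pmf.expectation (wc_output N f R k) (\<lambda>P. best f P k')
                \<ge> 1 / 2 * (1 - 1 / (\<omega> * real k)) ^ k * best f N k')"
    using wc_output_card_le wc_output_expectation_ge by blast
  show "\<exists>C (\<delta> :: real \<Rightarrow> nat \<Rightarrow> real).
      (\<forall>\<omega>\<ge>1. \<forall>k\<ge>1. \<bar>\<delta> \<omega> k\<bar> \<le> C * (1 / (\<omega>\<^sup>2 * real k))) \<and>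
      (\<forall>(N :: 'a set) f k \<omega> R. wc_instance N f k \<omega> R \<longrightarrow>
        (\<forall>k'\<le>k. 1 / 2 * (1 - 1 / (\<omega> * real k)) ^ k * best f N k'
                  = exp (- 1 / \<omega>) / 2 * (1 - \<delta> \<omega> k) * best f N k'))"
    \<comment> \<open>The witnesses are \<open>C = 1\<close> and \<open>rel_error\<close>.\<close>
    using rel_error_bounds
    by (intro exI[of _ 1] exI[of _ rel_error] conjI allI impI)
      (simp_all only: factor_eq_rel_error abs_of_nonneg mult_1)
  show "\<forall>\<omega>\<ge>1. \<forall>\<epsilon>>0. \<forall>\<^sub>F k in sequentially.
      \<forall>(N :: 'a set) f R. wc_instance N f k \<omega> R \<longrightarrow>
        (\<forall>k'\<le>k. measure_pmf.expectation (wc_output N f R k) (\<lambda>P. best f P k')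
                  \<ge> (1 - \<epsilon>) * (exp (- 1 / \<omega>) / 2) * best f N k')"
  proof (intro allI impI)
    fix \<omega> \<epsilon> :: real
    assume w: "1 \<le> \<omega>" and e: "0 < \<epsilon>"
    have "(\<lambda>k. 1 / (\<omega>\<^sup>2 * real k)) \<longlonglongrightarrow> 0"
      using w by real_asymp
    then have "\<forall>\<^sub>F k in sequentially. 1 / (\<omega>\<^sup>2 * real k) < \<epsilon>"
      using e by (rule order_tendstoD)
    then show "\<forall>\<^sub>F k in sequentially. \<forall>(N :: 'a set) f R. wc_instance N f k \<omega> R \<longrightarrow>
        (\<forall>k'\<le>k. measure_pmf.expectation (wc_output N f R k) (\<lambda>P. best f P k')
                  \<ge> (1 - \<epsilon>) * (exp (- 1 / \<omega>) / 2) * best f N k')"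
    proof (eventually_elim, intro allI impI)
      fix k k' :: nat and N :: "'a set" and f R
      assume k: "1 / (\<omega>\<^sup>2 * real k) < \<epsilon>" and inst: "wc_instance N f k \<omega> R" and k': "k' \<le> k"
      \<comment> \<open>The threshold for \<open>k\<close> depends only on \<open>\<omega>\<close>
        and \<open>\<epsilon>\<close>, so it is uniform in \<open>N\<close>, \<open>f\<close> and
        \<open>R\<close>; the instance supplies \<open>1 \<le> k\<close>.\<close>
      have "rel_error \<omega> k \<le> \<epsilon>"
        using rel_error_bounds(2)[OF instance_params(1,2)[OF inst]] k by linarith
      then have "(1 - \<epsilon>) * (exp (- 1 / \<omega>) / 2) * best f N k'
          \<le> exp (- 1 / \<omega>) / 2 * (1 - rel_error \<omega> k) * best f N k'"
        using best_ground_nonneg[OF inst] by (intro mult_right_mono) (auto simp: mult_ac)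
      also have "\<dots> \<le> measure_pmf.expectation (wc_output N f R k) (\<lambda>P. best f P k')"
        using wc_output_expectation_ge[OF inst k'] by (simp only: factor_eq_rel_error)
      finally show "(1 - \<epsilon>) * (exp (- 1 / \<omega>) / 2) * best f N k'
          \<le> measure_pmf.expectation (wc_output N f R k) (\<lambda>P. best f P k')" .
    qed
  qed
  show "((\<lambda>\<omega>::real. exp (- 1 / \<omega>) / 2) \<longlongrightarrow> 1 / 2) at_top"
    by real_asymp
  show "\<forall>k\<ge>1. ((\<lambda>\<omega>::real. 1 / 2 * (1 - 1 / (\<omega> * real k)) ^ k) \<longlongrightarrow> 1 / 2) at_top"
  proof (intro allI impI)
    fix k :: nat
    assume "1 \<le> k"
    then have "((\<lambda>\<omega>::real. 1 / (\<omega> * real k)) \<longlongrightarrow> 0) at_top"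
      by real_asymp
    then have "((\<lambda>\<omega>::real. 1 / 2 * (1 - 1 / (\<omega> * real k)) ^ k) \<longlongrightarrow> 1 / 2 * (1 - 0) ^ k) at_top"
      by (intro tendsto_intros)
    then show "((\<lambda>\<omega>::real. 1 / 2 * (1 - 1 / (\<omega> * real k)) ^ k) \<longlongrightarrow> 1 / 2) at_top"
      by simp
  qed
  show "\<exists>C::real. \<forall>(N :: 'a set) f k \<omega> R. wc_instance N f k \<omega> R \<longrightarrow>
      (\<forall>q \<in> set_pmf (wc_queries N f R k). real q \<le> C * (real (card N) * real k))"
    using wc_queries_le by blast
qed

end
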